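(* Let $\Omega\subset\mathbb{R}^K$ be compact, let $A:\mathbb{R}^M\to\mathbb{R}^M$ be a vector field with exact flow $\mathcal{E}$, and let $\Phi:\mathbb{R}^+\times\mathbb{R}^M\times\Omega\to\mathbb{R}^M$ be the numerical flow of a single step method $\boldsymbol{u}_{n+1}=\Phi(\Delta t,\boldsymbol{u}_n,\chi)$ for the ODE system $\frac{\mathrm{d}}{\mathrm{d}t}\boldsymbol{u}(t)=A(\boldsymbol{u}(t))$, depending on a parameter vector $\chi\in\Omega$. Assume that $A$, $\mathcal{E}$ and $\Phi$ are smooth with respect to all arguments, and that the method is of order $p$ (for every $\chi\in\Omega$). Fix $\boldsymbol{u}_n\in\mathbb{R}^M$. Let $\mathcal{L}(\Delta t,\boldsymbol{u}_n,\chi)$ be the local error, let $\mathcal{R}(\Delta t,\boldsymbol{u}_n,\chi)$ be the defect, and let $$L(\Delta t,\boldsymbol{u}_n,\chi)=\frac{\Delta t}{p+1}\,\mathcal{R}(\Delta t,\boldsymbol{u}_n,\chi).$$ Then $L$ is an asymptotically correct estimator of the local error, uniformly in $\chi\in\Omega$: for every $\Delta t_0>0$ there is a constant $C$, independent of $\chi$ and of $\Delta t$, such that $$\|L(\Delta t,\boldsymbol{u}_n,\chi)-\mathcal{L}(\Delta t,\boldsymbol{u}_n,\chi)\|\le C\,\Delta t^{p+2}\qquad\text{for all }\chi\in\Omega\text{ and all }\Delta t\in(0,\Delta t_0].$$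
   Context: Here $\mathbb{R}^+=[0,\infty)$, $M,K,p$ are positive integers, and $\|\cdot\|$ is a fixed norm on $\mathbb{R}^M$. The exact flow $\mathcal{E}:\mathbb{R}^+\times\mathbb{R}^M\to\mathbb{R}^M$ is the map such that $\boldsymbol{u}(t)=\mathcal{E}(t,\boldsymbol{u}_0)$ is the solution of $\frac{\mathrm{d}}{\mathrm{d}t}\boldsymbol{u}(t)=A(\boldsymbol{u}(t))$, $t\ge 0$, with $\boldsymbol{u}(0)=\boldsymbol{u}_0$; it is assumed to exist for all $t\ge 0$ and all $\boldsymbol{u}_0\in\mathbb{R}^M$. Smoothness of $A$, $\mathcal{E}$, $\Phi$ with respect to all arguments means that their partial derivatives of all orders exist and are jointly continuous in all arguments, including up to $\Delta t=0$ (respectively $t=0$), where derivatives in time are one-sided; smoothness in $\chi\in\Omega$ means that $\Phi$ is the restriction of a function that is smooth on an open neighbourhood of $\Omega$ in the variable $\chi$. The local error of the method is $$\mathcal{L}(\Delta t,\boldsymbol{u}_n,\chi)=\Phi(\Delta t,\boldsymbol{u}_n,\chi)-\mathcal{E}(\Delta t,\boldsymbol{u}_n).$$ The method is of order $p$ if, for every $\chi\in\Omega$ and every starting value $\boldsymbol{u}\in\mathbb{R}^M$, $\mathcal{L}(\Delta t,\boldsymbol{u},\chi)=\mathcal{O}(\Delta t^{p+1})$ as $\Delta t\to 0$. The defect (residual) of $\Phi$ is $$\mathcal{R}(\Delta t,\boldsymbol{u}_n,\chi)=\frac{\mathrm{d}}{\mathrm{d}\Delta t}\Phi(\Delta t,\boldsymbol{u}_n,\chi)-A\big(\Phi(\Delta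 t,\boldsymbol{u}_n,\chi)\big).$$ *)

theory Defs
  imports "HOL-Analysis.Analysis" "HOL-Library.Landau_Symbols"
begin

definition is_norm :: "('a::real_vector \<Rightarrow> real) \<Rightarrow> bool" where
  "is_norm N \<longleftrightarrow>
     (\<forall>x. N x = 0 \<longleftrightarrow> x = 0) \<and>
     (\<forall>c x. N (c *\<^sub>R x) = \<bar>c\<bar> * N x) \<and>
     (\<forall>x y. N (x + y) \<le> N x + N y)"

text \<open>
  Partial derivatives are taken relative to the domain \<open>S\<close>: at a point of \<open>S\<close> lying on the
  face \<open>t = 0\<close> of a set of the form \<open>{0..} \<times> V\<close>, the derivative in the direction of \<open>t\<close> is
  one-sided. The definition is meant for sets \<open>S\<close> such that \<open>0\<close> is a limit point
  of \<open>{h. x + h *\<^sub>R b \<in> S}\<close> for all \<open>x \<in> S\<close> and \<open>b \<in> Basis\<close> (for instance products of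
  \<open>{0..}\<close> with open sets), so that partial derivatives are unique.
\<close>

definition line_section :: "'a::euclidean_space set \<Rightarrow> 'a \<Rightarrow> 'a \<Rightarrow> real set" where
  "line_section S b x = {h. x + h *\<^sub>R b \<in> S}"

definition partial_deriv ::
  "'a::euclidean_space set \<Rightarrow> 'a \<Rightarrow> ('a \<Rightarrow> 'b::real_normed_vector) \<Rightarrow> 'a \<Rightarrow> 'b" where
  "partial_deriv S b f x =
     vector_derivative (\<lambda>h. f (x + h *\<^sub>R b)) (at 0 within line_section S b x)"

definition has_partial_deriv_on ::
  "('a::euclidean_space \<Rightarrow> 'b::real_normed_vector) \<Rightarrow> 'a \<Rightarrow> 'a set \<Rightarrow> bool" where
  "has_partial_deriv_on f b S \<longleftrightarrow>
     (\<forall>x\<in>S. (\<lambda>h. f (x + h *\<^sub>R b)) differentiable (at 0 within line_section S b x))"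

text \<open>
  A list \<open>bs\<close> of basis vectors encodes the iterated partial derivative of order \<open>length bs\<close>
  in these coordinate directions; the empty list gives \<open>f\<close> itself.
\<close>

definition smooth_on :: "'a::euclidean_space set \<Rightarrow> ('a \<Rightarrow> 'b::real_normed_vector) \<Rightarrow> bool" where
  "smooth_on S f \<longleftrightarrow>
     (\<forall>bs\<in>lists Basis.
        continuous_on S (foldr (partial_deriv S) bs f) \<and>
        (\<forall>b\<in>Basis. has_partial_deriv_on (foldr (partial_deriv S) bs f) b S))"

definition smooth_flow :: "(real \<Rightarrow> 'a::euclidean_space \<Rightarrow> 'a) \<Rightarrow> bool" where
  "smooth_flow E \<longleftrightarrow> smooth_on ({0..} \<times> UNIV) (\<lambda>(t, u). E t u)"

definition smooth_numerical_flow ::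
  "'c::euclidean_space set \<Rightarrow> (real \<Rightarrow> 'a::euclidean_space \<Rightarrow> 'c \<Rightarrow> 'a) \<Rightarrow> bool" where
  "smooth_numerical_flow \<Omega> \<Phi> \<longleftrightarrow>
     (\<exists>U \<Psi>. open U \<and> \<Omega> \<subseteq> U \<and>
        smooth_on ({0..} \<times> UNIV \<times> U) (\<lambda>(t, u, w). \<Psi> t u w) \<and>
        (\<forall>t\<ge>0. \<forall>u. \<forall>w\<in>\<Omega>. \<Phi> t u w = \<Psi> t u w))"

text \<open>
  Uniqueness of the solution is not part of this definition; it is automatic for smooth \<open>A\<close>.
\<close>

definition is_exact_flow ::
  "('a::real_normed_vector \<Rightarrow> 'a) \<Rightarrow> (real \<Rightarrow> 'a \<Rightarrow> 'a) \<Rightarrow> bool" where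
  "is_exact_flow A E \<longleftrightarrow>
     (\<forall>u\<^sub>0. E 0 u\<^sub>0 = u\<^sub>0 \<and>
        (\<forall>t\<ge>0. ((\<lambda>s. E s u\<^sub>0) has_vector_derivative A (E t u\<^sub>0)) (at t within {0..})))"

definition local_error ::
  "(real \<Rightarrow> 'a::real_normed_vector \<Rightarrow> 'a) \<Rightarrow> (real \<Rightarrow> 'a \<Rightarrow> 'c \<Rightarrow> 'a) \<Rightarrow>
   real \<Rightarrow> 'a \<Rightarrow> 'c \<Rightarrow> 'a" where
  "local_error E \<Phi> dt u w = \<Phi> dt u w - E dt u"

definition has_order ::
  "('a::real_normed_vector \<Rightarrow> real) \<Rightarrow> 'c set \<Rightarrow> (real \<Rightarrow> 'a \<Rightarrow> 'a) \<Rightarrow>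
   (real \<Rightarrow> 'a \<Rightarrow> 'c \<Rightarrow> 'a) \<Rightarrow> nat \<Rightarrow> bool" where
  "has_order N \<Omega> E \<Phi> p \<longleftrightarrow>
     (\<forall>w\<in>\<Omega>. \<forall>u. (\<lambda>dt. N (local_error E \<Phi> dt u w)) \<in> O[at_right 0](\<lambda>dt. dt ^ (p + 1)))"

definition defect ::
  "('a::real_normed_vector \<Rightarrow> 'a) \<Rightarrow> (real \<Rightarrow> 'a \<Rightarrow> 'c \<Rightarrow> 'a) \<Rightarrow>
   real \<Rightarrow> 'a \<Rightarrow> 'c \<Rightarrow> 'a" where
  "defect A \<Phi> dt u w =
     vector_derivative (\<lambda>s. \<Phi> s u w) (at dt within {0..}) - A (\<Phi> dt u w)"

definition error_estimator ::
  "nat \<Rightarrow> ('a::real_normed_vector \<Rightarrow> 'a) \<Rightarrow> (real \<Rightarrow> 'a \<Rightarrow> 'c \<Rightarrow> 'a) \<Rightarrow>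
   real \<Rightarrow> 'a \<Rightarrow> 'c \<Rightarrow> 'a" where
  "error_estimator p A \<Phi> dt u w = (dt / real (p + 1)) *\<^sub>R defect A \<Phi> dt u w"

end

theory Submission
  imports Defs
begin

text \<open>
  Write \<open>e(t) = \<Phi>(t) - E(t)\<close>. Order \<open>p\<close> together with smoothness makes all time
  derivatives of \<open>e\<close> at \<open>0\<close> up to order \<open>p\<close> vanish, so with \<open>c\<close> the derivative of order \<open>p + 1\<close> at \<open>0\<close>,
  \<open>e(t) = t^(p+1) / (p+1)! c + O(t^(p+2))\<close> and \<open>e'(t) = t^p / p! c + O(t^(p+1))\<close>. The leading terms
  cancel in \<open>t e'(t) - (p+1) e(t) = O(t^(p+2))\<close>. The defect is \<open>e'(t) + A(E(t)) - A(\<Phi>(t))\<close>, and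
  by local Lipschitz continuity of \<open>A\<close> it differs from \<open>e'(t)\<close> by \<open>O(t^(p+1))\<close> only. Compactness
  of \<open>\<Omega>\<close> makes all remainders uniform.
\<close>

section \<open>Norms and Lipschitz bounds\<close>

lemma is_norm_nonneg:
  assumes "is_norm N"
  shows "0 \<le> N x"
proof -
  have "N (x + (-1) *\<^sub>R x) \<le> N x + N ((-1) *\<^sub>R x)" and "N ((-1) *\<^sub>R x) = \<bar>-1\<bar> * N x"
    and "N 0 = 0"
    using assms unfolding is_norm_def by blast+
  then show ?thesis by simp
qed

text \<open>Expanding \<open>x\<close> in the basis and using the triangle inequality and
  homogeneity gives the sum of \<open>N b\<close> as constant. The derivative estimates below are
  proved in the Euclidean norm; this bound carries them over to \<open>N\<close>.\<close>

lemma is_norm_le_norm: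
  fixes N :: "'a::euclidean_space \<Rightarrow> real"
  assumes N: "is_norm N"
  obtains c where "0 \<le> c" "\<And>x. N x \<le> c * norm x"
proof
  show "0 \<le> (\<Sum>b\<in>Basis. N b)"
    by (intro sum_nonneg is_norm_nonneg[OF N])
  fix x :: 'a
  have scale: "\<And>c x. N (c *\<^sub>R x) = \<bar>c\<bar> * N x" and tri: "\<And>x y. N (x + y) \<le> N x + N y"
    and zero: "N 0 = 0"
    using N unfolding is_norm_def by blast+
  have sum: "N (sum g B) \<le> (\<Sum>b\<in>B. N (g b))" if "finite B" for g :: "'a \<Rightarrow> 'a" and B
    using that
  proof induction
    case (insert b B)
    then show ?case using tri[of "g b" "sum g B"] by simp
  qed (simp add: zero)
  have "N x = N (\<Sum>b\<in>Basis. (x \<bullet> b) *\<^sub>R b)"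
    by (simp add: euclidean_representation)
  also have "\<dots> \<le> (\<Sum>b\<in>Basis. N ((x \<bullet> b) *\<^sub>R b))"
    by (rule sum) simp
  also have "\<dots> \<le> (\<Sum>b\<in>Basis. N b * norm x)"
    by (rule sum_mono)
      (simp add: scale mult.commute Basis_le_norm mult_left_mono is_norm_nonneg[OF N])
  finally show "N x \<le> (\<Sum>b\<in>Basis. N b) * norm x"
    by (simp add: sum_distrib_right)
qed

text \<open>\<open>smooth_on\<close> speaks of partial derivatives only, so no total derivative is
  formed. The partial derivatives are continuous, hence bounded on a compact box around
  \<open>X\<close>; the mean value inequality is applied along one coordinate direction at a time
  and the bounds are added up.\<close>

lemma smooth_on_bounded_lipschitz:
  fixes f :: "'a::euclidean_space \<Rightarrow> 'b::real_normed_vector"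
  assumes f: "smooth_on UNIV f" and "bounded X"
  obtains L where "0 \<le> L" "\<And>x y. x \<in> X \<Longrightarrow> y \<in> X \<Longrightarrow> norm (f x - f y) \<le> L * norm (x - y)"
proof -
  obtain a where X: "X \<subseteq> cbox (-a) a"
    using bounded_subset_cbox_symmetric[OF \<open>bounded X\<close>] by blast
  have cont: "continuous_on UNIV (partial_deriv UNIV b f)" if "b \<in> Basis" for b
    using f[unfolded smooth_on_def, rule_format, of "[b]"] that by simp
  have deriv: "((\<lambda>h. f (x + h *\<^sub>R b)) has_vector_derivative partial_deriv UNIV b f x) (at 0)"
    if "b \<in> Basis" for x b
  proof -
    have "has_partial_deriv_on f b UNIV"
      using f[unfolded smooth_on_def, rule_format, of "[]"] that by simp
    then show ?thesis
      unfolding has_partial_deriv_on_def partial_deriv_def line_section_def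
      by (auto simp flip: vector_derivative_works)
  qed
  have "\<forall>b\<in>Basis. \<exists>K\<ge>0. \<forall>x\<in>cbox (-a) a. norm (partial_deriv UNIV b f x) \<le> K"
  proof
    fix b :: 'a assume b: "b \<in> Basis"
    have "bounded (partial_deriv UNIV b f ` cbox (-a) a)"
      by (intro compact_imp_bounded compact_continuous_image continuous_on_subset[OF cont[OF b]])
        auto
    then show "\<exists>K\<ge>0. \<forall>x\<in>cbox (-a) a. norm (partial_deriv UNIV b f x) \<le> K"
      unfolding bounded_pos by (auto intro: less_imp_le)
  qed
  then obtain K where K0: "\<And>b. b \<in> Basis \<Longrightarrow> 0 \<le> K b"
    and K: "\<And>b x. b \<in> Basis \<Longrightarrow> x \<in> cbox (-a) a \<Longrightarrow> norm (partial_deriv UNIV b f x) \<le> K b"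
    by metis
  have step: "norm (f (x + s *\<^sub>R b) - f x) \<le> K b * \<bar>s\<bar>"
    if b: "b \<in> Basis" and x: "x \<in> cbox (-a) a" and y: "x + s *\<^sub>R b \<in> cbox (-a) a" for x b s
  proof -
    \<comment> \<open>Mean value inequality in the scalar parameter \<open>h\<close>. The closed
      segment from 0 to \<open>s\<close> covers both signs of \<open>s\<close>, and convexity of the
      box keeps \<open>x + h *\<^sub>R b\<close> inside it.\<close>
    have "norm (f (x + s *\<^sub>R b) - f (x + 0 *\<^sub>R b)) \<le> K b * norm (s - 0)"
    proof (rule differentiable_bound[where S = "closed_segment 0 s"
          and f' = "\<lambda>h k. k *\<^sub>R partial_deriv UNIV b f (x + h *\<^sub>R b)"])
      fix h assume "h \<in> closed_segment 0 s"
      then obtain r where r: "0 \<le> r" "r \<le> 1" "h = r * s"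
        by (auto simp: in_segment)
      have "x + h *\<^sub>R b = (1 - r) *\<^sub>R x + r *\<^sub>R (x + s *\<^sub>R b)"
        by (simp add: r algebra_simps)
      also have "\<dots> \<in> cbox (-a) a"
        using convexD_alt[OF convex_box(1) x y r(1,2)] .
      finally have "norm (partial_deriv UNIV b f (x + h *\<^sub>R b)) \<le> K b"
        using K b by blast
      then show "onorm (\<lambda>k. k *\<^sub>R partial_deriv UNIV b f (x + h *\<^sub>R b)) \<le> K b"
        by (intro onorm_le) (simp add: mult.commute mult_left_mono)
      \<comment> \<open>The partial derivative lives at parameter 0 with base point
        \<open>x + h *\<^sub>R b\<close>. Writing 0 as \<open>h - h\<close> lets the chain rule with
        a shift turn it into a derivative at parameter \<open>h\<close> with base point
        \<open>x\<close>.\<close>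
      have "((\<lambda>k. f ((x + h *\<^sub>R b) + k *\<^sub>R b)) has_vector_derivative
          partial_deriv UNIV b f (x + h *\<^sub>R b)) (at ((\<lambda>k. k - h) h))"
        using deriv[OF b] by simp
      moreover have "((\<lambda>k. k - h) has_vector_derivative 1) (at h)"
        by (auto intro!: derivative_eq_intros)
      ultimately have "((\<lambda>k. f (x + k *\<^sub>R b)) has_vector_derivative
          partial_deriv UNIV b f (x + h *\<^sub>R b)) (at h)"
        by (auto dest!: vector_diff_chain_at simp: o_def algebra_simps)
      then show "((\<lambda>k. f (x + k *\<^sub>R b)) has_derivative
          (\<lambda>k. k *\<^sub>R partial_deriv UNIV b f (x + h *\<^sub>R b))) (at h within closed_segment 0 s)"
        by (simp add: has_vector_derivative_def has_derivative_at_withinI)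
    qed auto
    then show ?thesis by simp
  qed
  \<comment> \<open>Moving from \<open>x\<close> to \<open>y\<close> one coordinate at a time stays inside the box.\<close>
  have path: "norm (f x - f y) \<le> (\<Sum>b\<in>B. K b * \<bar>(x - y) \<bullet> b\<bar>)"
    if "finite B" "B \<subseteq> Basis" "x \<in> cbox (-a) a" "y \<in> cbox (-a) a"
      "\<And>b. b \<in> Basis - B \<Longrightarrow> x \<bullet> b = y \<bullet> b" for B x y
    using that
  proof (induction B arbitrary: x rule: finite_induct)
    case empty
    then have "x = y" by (auto intro: euclidean_eqI)
    then show ?case by simp
  next
    case (insert b B)
    then have b: "b \<in> Basis" by simp
    \<comment> \<open>The step \<open>s\<close> replaces coordinate \<open>b\<close> of
      \<open>x\<close> by that of \<open>y\<close>, so \<open>z\<close> differs from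
      \<open>y\<close> at most in the coordinates of \<open>B\<close>, and the induction hypothesis
      applies to \<open>z\<close>.\<close>
    define s where "s = (y - x) \<bullet> b"
    define z where "z = x + s *\<^sub>R b"
    have zc: "z \<bullet> c = (if c = b then y \<bullet> b else x \<bullet> c)" if "c \<in> Basis" for c
      using that b by (auto simp: z_def s_def inner_simps inner_Basis)
    have z: "z \<in> cbox (-a) a"
      using insert.prems by (auto simp: mem_box zc)
    have "norm (f z - f y) \<le> (\<Sum>c\<in>B. K c * \<bar>(z - y) \<bullet> c\<bar>)"
      using insert.prems z zc by (intro insert.IH) auto
    also have "\<dots> = (\<Sum>c\<in>B. K c * \<bar>(x - y) \<bullet> c\<bar>)"
    proof (rule sum.cong)
      fix c assume "c \<in> B"
      then have "z \<bullet> c = x \<bullet> c"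
        using insert.hyps insert.prems(1) zc by auto
      then show "K c * \<bar>(z - y) \<bullet> c\<bar> = K c * \<bar>(x - y) \<bullet> c\<bar>"
        by (simp add: inner_diff_left)
    qed simp
    finally have 1: "norm (f z - f y) \<le> (\<Sum>c\<in>B. K c * \<bar>(x - y) \<bullet> c\<bar>)" .
    have 2: "norm (f z - f x) \<le> K b * \<bar>(x - y) \<bullet> b\<bar>"
      using step[OF b insert.prems(2), of s] z
      by (simp add: z_def s_def inner_diff_left abs_minus_commute)
    have "norm (f x - f y) \<le> norm (f z - f x) + norm (f z - f y)"
      by (metis norm_minus_commute norm_triangle_sub diff_add_cancel norm_diff_triangle_le order_refl)
    with 1 2 show ?case
      using insert.hyps by simp
  qed
  show thesis
  proof
    show "0 \<le> (\<Sum>b\<in>Basis. K b)"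
      by (intro sum_nonneg K0)
    fix x y assume "x \<in> X" "y \<in> X"
    then have "norm (f x - f y) \<le> (\<Sum>b\<in>Basis. K b * \<bar>(x - y) \<bullet> b\<bar>)"
      using X by (intro path) auto
    also have "\<dots> \<le> (\<Sum>b\<in>Basis. K b * norm (x - y))"
      by (intro sum_mono mult_left_mono K0 Basis_le_norm)
    finally show "norm (f x - f y) \<le> (\<Sum>b\<in>Basis. K b) * norm (x - y)"
      by (simp add: sum_distrib_right)
  qed
qed

section \<open>Leading terms of Taylor expansions\<close>

text \<open>Integrating the bound on \<open>g'\<close> would give the factor
  \<open>1 / (n + 1)\<close>. It is discarded so that the same \<open>C\<close> survives repeated
  integration.\<close>

lemma norm_le_power_Suc:
  fixes g :: "real \<Rightarrow> 'b::real_normed_vector"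
  assumes g: "\<And>s. 0 \<le> s \<Longrightarrow> (g has_vector_derivative g' s) (at s within {0..})"
    and "g 0 = 0" and "0 \<le> C" and bnd: "\<And>s. 0 \<le> s \<Longrightarrow> s \<le> t \<Longrightarrow> norm (g' s) \<le> C * s ^ n"
    and "0 \<le> t"
  shows "norm (g t) \<le> C * t ^ Suc n"
proof (cases "t = 0")
  case False
  then have "0 < t" using \<open>0 \<le> t\<close> by simp
  have "norm (g t - g 0) \<le> C * t ^ Suc n / real (Suc n) - C * 0 ^ Suc n / real (Suc n)"
  proof (rule differentiable_bound_general[OF \<open>0 < t\<close>, where f' = g'
        and \<phi> = "\<lambda>s. C * s ^ Suc n / real (Suc n)" and \<phi>' = "\<lambda>s. C * s ^ n"])
    have "continuous_on {0..} g"
      by (rule continuous_on_vector_derivative[of _ _ g']) (simp add: g)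
    then show "continuous_on {0..t} g"
      by (rule continuous_on_subset) auto
    \<comment> \<open>The mean value inequality wants two-sided derivatives at interior points;
      there the restriction to \<open>{0..}\<close> has no effect.\<close>
    show "(g has_vector_derivative g' s) (at s)" if "0 < s" for s
    proof -
      have "at s within {0..} = at s"
        using that by (intro at_within_interior) auto
      with g[of s] that show ?thesis by simp
    qed
    show "((\<lambda>s. C * s ^ Suc n / real (Suc n)) has_vector_derivative C * s ^ n) (at s)" for s
      unfolding has_real_derivative_iff_has_vector_derivative[symmetric]
      by (rule derivative_eq_intros refl | simp)+
  qed (use bnd in \<open>auto intro!: continuous_intros\<close>)
  also have "\<dots> \<le> C * t ^ Suc n / 1"
    using divide_left_mono[of 1 "real (Suc n)" "C * t ^ Suc n"] \<open>0 \<le> C\<close> \<open>0 \<le> t\<close> by simp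
  finally show ?thesis using \<open>g 0 = 0\<close> by simp
qed (use assms in auto)

text \<open>\<open>D j\<close> plays the role of the derivative of order \<open>j\<close>. By
  induction, the shifted family starting at \<open>D 1\<close> has the expansion with one power
  less; integrating it from 0 gives the expansion of \<open>D 0\<close>, because
  \<open>D 0 0 = 0\<close> once \<open>n\<close> is positive.\<close>

lemma taylor_leading_term:
  fixes D :: "nat \<Rightarrow> real \<Rightarrow> 'b::real_normed_vector"
  assumes "\<And>j s. 0 \<le> s \<Longrightarrow> (D j has_vector_derivative D (Suc j) s) (at s within {0..})"
    and "\<And>j. j < n \<Longrightarrow> D j 0 = 0"
    and "\<And>s. 0 \<le> s \<Longrightarrow> s \<le> T \<Longrightarrow> norm (D (Suc n) s) \<le> C"
    and "0 \<le> t" "t \<le> T"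
  shows "norm (D 0 t - (t ^ n / fact n) *\<^sub>R D n 0) \<le> C * t ^ Suc n"
  using assms
proof (induction n arbitrary: D t)
  case 0
  have C: "0 \<le> C"
    by (rule order_trans[OF norm_ge_zero 0(3)[OF 0(4,5)]])
  have "norm ((\<lambda>s. D 0 s - D 0 0) t) \<le> C * t ^ Suc 0"
  proof (rule norm_le_power_Suc[OF _ _ C])
    show "((\<lambda>s. D 0 s - D 0 0) has_vector_derivative D 1 s) (at s within {0..})" if "0 \<le> s" for s
      using 0(1)[OF that, of 0] by (auto intro!: derivative_eq_intros)
  qed (use 0 in auto)
  then show ?case by simp
next
  case (Suc n)
  have C: "0 \<le> C"
    by (rule order_trans[OF norm_ge_zero Suc.prems(3)[OF Suc.prems(4,5)]])
  have IH: "norm (D (Suc 0) s - (s ^ n / fact n) *\<^sub>R D (Suc n) 0) \<le> C * s ^ Suc n"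
    if "0 \<le> s" "s \<le> T" for s
    by (rule Suc.IH[of "\<lambda>j. D (Suc j)"]) (use Suc.prems that in auto)
  have "norm ((\<lambda>s. D 0 s - (s ^ Suc n / fact (Suc n)) *\<^sub>R D (Suc n) 0) t) \<le> C * t ^ Suc (Suc n)"
  proof (rule norm_le_power_Suc[OF _ _ C])
    fix s :: real assume s: "0 \<le> s"
    have "((\<lambda>s. s ^ Suc n / fact (Suc n)) has_field_derivative s ^ n / fact n) (at s within {0..})"
      by (rule derivative_eq_intros refl | simp)+
    from has_vector_derivative_scaleR[OF this has_vector_derivative_const[of "D (Suc n) 0"]]
    show "((\<lambda>s. D 0 s - (s ^ Suc n / fact (Suc n)) *\<^sub>R D (Suc n) 0) has_vector_derivative
        D (Suc 0) s - (s ^ n / fact n) *\<^sub>R D (Suc n) 0) (at s within {0..})"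
      by (intro has_vector_derivative_diff Suc.prems(1) s) (simp del: power_Suc fact_Suc)
  qed (use Suc.prems IH in auto)
  then show ?case by simp
qed

text \<open>Strong induction on \<open>j\<close>: once the lower derivatives vanish,
  \<open>D 0 t\<close> equals \<open>t^j / j!\<close> times \<open>D j 0\<close> up to
  \<open>O(t^(j+1))\<close>. It is itself \<open>O(t^(p+1))\<close> with \<open>j \<le> p\<close>,
  so dividing by \<open>t^j\<close> and letting \<open>t\<close> tend to 0 forces
  \<open>D j 0 = 0\<close>.\<close>

lemma bigo_imp_derivs_zero:
  fixes D :: "nat \<Rightarrow> real \<Rightarrow> 'b::euclidean_space"
  assumes N: "is_norm N"
    and D: "\<And>j s. 0 \<le> s \<Longrightarrow> (D j has_vector_derivative D (Suc j) s) (at s within {0..})"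
    and O: "(\<lambda>t. N (D 0 t)) \<in> O[at_right 0](\<lambda>t. t ^ Suc p)"
    and "j \<le> p"
  shows "D j 0 = 0"
  using \<open>j \<le> p\<close>
proof (induction j rule: less_induct)
  case (less j)
  have scale: "\<And>c x. N (c *\<^sub>R x) = \<bar>c\<bar> * N x" and tri: "\<And>x y. N (x + y) \<le> N x + N y"
    and zero: "\<And>x. N x = 0 \<longleftrightarrow> x = 0"
    using N unfolding is_norm_def by blast+
  have neg: "N (- x) = N x" for x
    using scale[of "-1" x] by simp
  obtain c where c: "0 \<le> c" "\<And>x. N x \<le> c * norm x"
    using is_norm_le_norm[OF N] by blast
  have "continuous_on {0..1} (D (Suc j))"
    by (rule continuous_on_subset[where s = "{0..}"])
      (auto intro!: continuous_on_vector_derivative D)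
  then have "bounded (D (Suc j) ` {0..1})"
    by (intro compact_imp_bounded compact_continuous_image) auto
  then obtain C where "\<forall>s\<in>{0..1}. norm (D (Suc j) s) \<le> C"
    unfolding bounded_iff by blast
  then have C: "norm (D (Suc j) s) \<le> C" if "0 \<le> s" "s \<le> 1" for s
    using that by simp
  obtain K where K: "0 < K" "\<forall>\<^sub>F t in at_right 0. norm (N (D 0 t)) \<le> K * norm (t ^ Suc p)"
    using O by (auto elim: landau_o.bigE)
  \<comment> \<open>\<open>K\<close> comes from the order condition and \<open>c * C\<close> from
    the Taylor remainder, converted to \<open>N\<close>. The left side does not depend on
    \<open>t\<close>, so the limit from the right bounds it by 0.\<close>
  have "\<forall>\<^sub>F t in at_right 0. N (D j 0) \<le> fact j * (K + c * C) * t"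
    using K(2) eventually_at_right_real[of 0 1, OF zero_less_one]
  proof eventually_elim
    case (elim t)
    then have t: "0 < t" "t < 1" by auto
    have 1: "norm (D 0 t - (t ^ j / fact j) *\<^sub>R D j 0) \<le> C * t ^ Suc j"
      by (rule taylor_leading_term[where T = 1]) (use t less C D in auto)
    have "(t ^ j / fact j) * N (D j 0) = N (D 0 t + - (D 0 t - (t ^ j / fact j) *\<^sub>R D j 0))"
      using t by (simp add: scale)
    also have "\<dots> \<le> N (D 0 t) + N (D 0 t - (t ^ j / fact j) *\<^sub>R D j 0)"
      using tri[of "D 0 t" "- (D 0 t - (t ^ j / fact j) *\<^sub>R D j 0)"] by (simp only: neg)
    also have "N (D 0 t) \<le> K * t ^ Suc p"
      using elim t by simp
    \<comment> \<open>Here \<open>t < 1\<close> is used: a smaller exponent gives a larger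
      power.\<close>
    also have "K * t ^ Suc p \<le> K * t ^ Suc j"
      using less.prems t K(1) by (intro mult_left_mono power_decreasing) auto
    also have "N (D 0 t - (t ^ j / fact j) *\<^sub>R D j 0) \<le> c * (C * t ^ Suc j)"
      using c(2) mult_left_mono[OF 1 c(1)] by (rule order_trans)
    finally have "(t ^ j / fact j) * N (D j 0) \<le> (t ^ j / fact j) * (fact j * (K + c * C) * t)"
      by (simp add: algebra_simps)
    then show ?case
      using t by (simp add: mult_le_cancel_left_pos del: times_divide_eq_left)
  qed
  moreover have "((\<lambda>t. fact j * (K + c * C) * t) \<longlongrightarrow> fact j * (K + c * C) * 0) (at_right 0)"
    by (intro tendsto_intros)
  ultimately have "N (D j 0) \<le> fact j * (K + c * C) * 0"
    by (intro tendsto_lowerbound[rotated]) auto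
  then have "N (D j 0) = 0"
    using is_norm_nonneg[OF N, of "D j 0"] by simp
  then show ?case by (simp add: zero)
qed

section \<open>Iterated time derivatives\<close>

text \<open>Iterating the partial derivative in the first coordinate direction yields all time
  derivatives, jointly continuous with the remaining variables \<open>x\<close> as parameters. The
  lemma serves both the numerical and the exact flow.\<close>

lemma smooth_on_time_derivs:
  fixes f :: "real \<times> 'a::euclidean_space \<Rightarrow> 'b::real_normed_vector"
  assumes "smooth_on ({0..} \<times> V) f"
  obtains F where "F 0 = f" "\<And>j. continuous_on ({0..} \<times> V) (F j)"
    "\<And>j t x. 0 \<le> t \<Longrightarrow> x \<in> V \<Longrightarrow>
      ((\<lambda>s. F j (s, x)) has_vector_derivative F (Suc j) (t, x)) (at t within {0..})"
proof -
  define S :: "(real \<times> 'a) set" where "S = {0..} \<times> V"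
  define b :: "real \<times> 'a" where "b = (1, 0)"
  define F where "F j = foldr (partial_deriv S) (replicate j b) f" for j
  have b: "b \<in> Basis" by (simp add: b_def Basis_prod_def)
  then have bs: "replicate j b \<in> lists Basis" for j by auto
  have F: "continuous_on S (F j)" "has_partial_deriv_on (F j) b S" for j
    using assms bs[of j] b unfolding smooth_on_def S_def F_def by blast+
  have deriv: "((\<lambda>s. F j (s, x)) has_vector_derivative F (Suc j) (t, x)) (at t within {0..})"
    if "0 \<le> t" "x \<in> V" for j t x
  proof -
    \<comment> \<open>The section is the half line \<open>{0..}\<close> moved by \<open>-t\<close>.
      The partial derivative relative to \<open>S\<close> is therefore the derivative within
      \<open>{0..}\<close>, one-sided at \<open>t = 0\<close>.\<close>
    have sec: "line_section S b (t, x) = (\<lambda>s. s - t) ` {0..}"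
      using that by (force simp: line_section_def S_def b_def image_iff intro: bexI[of _ "_ + t"])
    have "((\<lambda>h. F j ((t, x) + h *\<^sub>R b)) has_vector_derivative F (Suc j) (t, x))
        (at 0 within line_section S b (t, x))"
      using F(2)[of j] that unfolding has_partial_deriv_on_def
      by (auto simp: F_def partial_deriv_def S_def simp flip: vector_derivative_works)
    then have "((\<lambda>h. F j ((t, x) + h *\<^sub>R b)) has_vector_derivative F (Suc j) (t, x))
        (at ((\<lambda>s. s - t) t) within (\<lambda>s. s - t) ` {0..})"
      by (simp add: sec)
    moreover have "((\<lambda>s. s - t) has_vector_derivative 1) (at t within {0..})"
      by (auto intro!: derivative_eq_intros)
    ultimately show ?thesis
      by (auto dest!: vector_diff_chain_within simp: o_def b_def)
  qed
  show thesis
    by (rule that[of F]) (use F(1) deriv in \<open>auto simp: S_def F_def\<close>)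
qed

section \<open>Uniform remainder bounds and cancellation of the leading terms\<close>

theorem theorem2:
  fixes \<Omega> :: "(real ^ 'k) set"
    and A :: "real ^ 'm \<Rightarrow> real ^ 'm"
    and E :: "real \<Rightarrow> real ^ 'm \<Rightarrow> real ^ 'm"
    and \<Phi> :: "real \<Rightarrow> real ^ 'm \<Rightarrow> real ^ 'k \<Rightarrow> real ^ 'm"
    and N :: "real ^ 'm \<Rightarrow> real"
    and p :: nat
    and u :: "real ^ 'm"
  assumes "is_norm N"
    and "p \<ge> 1"
    and "compact \<Omega>"
    and "is_exact_flow A E"
    and "smooth_on UNIV A"
    and "smooth_flow E"
    and "smooth_numerical_flow \<Omega> \<Phi>"
    and "has_order N \<Omega> E \<Phi> p"
  shows "\<forall>dt\<^sub>0>0. \<exists>C. \<forall>w\<in>\<Omega>. \<forall>dt\<in>{0<..dt\<^sub>0}.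
    N (error_estimator p A \<Phi> dt u w - local_error E \<Phi> dt u w) \<le> C * dt ^ (p + 2)"
proof (intro allI impI)
  fix T :: real assume "0 < T"
  note N = \<open>is_norm N\<close>
  obtain c where c: "0 \<le> c" "\<And>x. N x \<le> c * norm x"
    using is_norm_le_norm[OF N] by blast
  obtain U \<Psi> where "\<Omega> \<subseteq> U"
    and smooth: "smooth_on ({0..} \<times> UNIV \<times> U) (\<lambda>(t, u, w). \<Psi> t u w)"
    and \<Psi>: "\<And>t u w. 0 \<le> t \<Longrightarrow> w \<in> \<Omega> \<Longrightarrow> \<Phi> t u w = \<Psi> t u w"
    using \<open>smooth_numerical_flow \<Omega> \<Phi>\<close> unfolding smooth_numerical_flow_def by blast
  obtain F where F0: "F 0 = (\<lambda>(t, u, w). \<Psi> t u w)"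
    and Fcont: "\<And>j. continuous_on ({0..} \<times> UNIV \<times> U) (F j)"
    and Fderiv: "\<And>j t x. 0 \<le> t \<Longrightarrow> x \<in> UNIV \<times> U \<Longrightarrow>
      ((\<lambda>s. F j (s, x)) has_vector_derivative F (Suc j) (t, x)) (at t within {0..})"
    by (rule smooth_on_time_derivs[OF smooth]) (rule that)
  obtain G where G0: "G 0 = (\<lambda>(t, u). E t u)"
    and Gcont: "\<And>j. continuous_on ({0..} \<times> UNIV) (G j)"
    and Gderiv: "\<And>j t x. 0 \<le> t \<Longrightarrow> x \<in> UNIV \<Longrightarrow>
      ((\<lambda>s. G j (s, x)) has_vector_derivative G (Suc j) (t, x)) (at t within {0..})"
    by (rule smooth_on_time_derivs[OF \<open>smooth_flow E\<close>[unfolded smooth_flow_def]]) (rule that)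
  define D where "D w j t = F j (t, u, w) - G j (t, u)" for w j t
  have D: "(D w j has_vector_derivative D w (Suc j) t) (at t within {0..})"
    if "w \<in> \<Omega>" "0 \<le> t" for w j t
    unfolding D_def using that \<open>\<Omega> \<subseteq> U\<close>
    by (intro has_vector_derivative_diff Fderiv Gderiv) auto
  have D0: "D w 0 t = local_error E \<Phi> t u w" if "w \<in> \<Omega>" "0 \<le> t" for w t
    using that by (simp add: D_def F0 G0 \<Psi> local_error_def)
  \<comment> \<open>Uniformity in the parameter starts here: the time derivatives are continuous on
    a compact set that contains all of \<open>\<Omega>\<close> at once.\<close>
  have Fbdd: "bounded (F j ` ({0..T} \<times> {u} \<times> \<Omega>))" for j
    using \<open>compact \<Omega>\<close> \<open>\<Omega> \<subseteq> U\<close>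
    by (intro compact_imp_bounded compact_continuous_image continuous_on_subset[OF Fcont]
        compact_Times) auto
  have Gbdd: "bounded (G j ` ({0..T} \<times> {u}))" for j
    by (intro compact_imp_bounded compact_continuous_image continuous_on_subset[OF Gcont]
        compact_Times) auto
  have "\<exists>B\<ge>0. \<forall>w\<in>\<Omega>. \<forall>t\<in>{0..T}. norm (D w j t) \<le> B" for j
  proof -
    obtain B1 B2 where B: "\<And>x. x \<in> {0..T} \<times> {u} \<times> \<Omega> \<Longrightarrow> norm (F j x) \<le> B1" "0 < B1"
      "\<And>x. x \<in> {0..T} \<times> {u} \<Longrightarrow> norm (G j x) \<le> B2" "0 < B2"
      using Fbdd[of j] Gbdd[of j] unfolding bounded_pos by (metis imageI)
    have "norm (D w j t) \<le> B1 + B2" if "w \<in> \<Omega>" "t \<in> {0..T}" for w t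
      unfolding D_def using that by (intro norm_triangle_le_diff add_mono B) auto
    then show ?thesis using B by (intro exI[of _ "B1 + B2"]) auto
  qed
  then obtain B where B0: "\<And>j. 0 \<le> B j"
    and B: "\<And>j w t. w \<in> \<Omega> \<Longrightarrow> t \<in> {0..T} \<Longrightarrow> norm (D w j t) \<le> B j"
    by metis
  have Dzero: "D w j 0 = 0" if w: "w \<in> \<Omega>" and "j < Suc p" for w j
  proof (rule bigo_imp_derivs_zero[OF N])
    \<comment> \<open>\<open>D w 0\<close> is known to agree with the local error for nonnegative
      times only, which suffices for a limit from the right.\<close>
    have "\<forall>\<^sub>F t in at_right 0. N (D w 0 t) = N (local_error E \<Phi> t u w)"
      using eventually_at_right_less[of 0] by eventually_elim (simp add: D0 w)
    moreover have "(\<lambda>t. N (local_error E \<Phi> t u w)) \<in> O[at_right 0](\<lambda>t. t ^ Suc p)"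
      using \<open>has_order N \<Omega> E \<Phi> p\<close> w unfolding has_order_def by simp
    ultimately show "(\<lambda>t. N (D w 0 t)) \<in> O[at_right 0](\<lambda>t. t ^ Suc p)"
      by (subst landau_o.big.in_cong)
  qed (use that D in auto)
  \<comment> \<open>One Lipschitz constant of \<open>A\<close> on the set of all values that the two
    flows take up to time \<open>T\<close>, hence independent of \<open>w\<close> and
    \<open>t\<close>.\<close>
  obtain L where L: "0 \<le> L" "\<And>x y. x \<in> F 0 ` ({0..T} \<times> {u} \<times> \<Omega>) \<union> G 0 ` ({0..T} \<times> {u}) \<Longrightarrow>
      y \<in> F 0 ` ({0..T} \<times> {u} \<times> \<Omega>) \<union> G 0 ` ({0..T} \<times> {u}) \<Longrightarrow> norm (A x - A y) \<le> L * norm (x - y)"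
    using smooth_on_bounded_lipschitz[OF \<open>smooth_on UNIV A\<close>] Fbdd Gbdd by (metis bounded_Un)
  \<comment> \<open>\<open>b\<close> bounds the derivative of order \<open>p + 2\<close>, which
    controls both Taylor remainders. \<open>M\<close> is chosen so that the error is at most
    \<open>M * t^(p+1)\<close>: \<open>b * T\<close> covers the remainder, with one factor
    \<open>t\<close> replaced by \<open>T\<close>, and \<open>B (Suc p)\<close> the leading
    term.\<close>
  define b where "b = B (Suc (Suc p))"
  define M where "M = b * T + B (Suc p)"
  have main: "N (error_estimator p A \<Phi> t u w - local_error E \<Phi> t u w)
      \<le> c * (2 * b + L * M) * t ^ (p + 2)" if w: "w \<in> \<Omega>" and t: "t \<in> {0<..T}" for w t
  proof -
    have t': "0 < t" "0 \<le> t" "t \<le> T" using t by auto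
    \<comment> \<open>The common coefficient of the expansions of the error and of its time
      derivative. The second is the expansion of order \<open>p\<close> of the shifted family, so
      its remainder also involves the derivative of order \<open>p + 2\<close>.\<close>
    define a where "a = D w (Suc p) 0"
    have e: "norm (D w 0 t - (t ^ Suc p / fact (Suc p)) *\<^sub>R a) \<le> b * t ^ Suc (Suc p)"
      unfolding a_def b_def
      by (rule taylor_leading_term[where T = T]) (use t' w B D Dzero in auto)
    have e': "norm (D w 1 t - (t ^ p / fact p) *\<^sub>R a) \<le> b * t ^ Suc p"
      unfolding a_def b_def
      using taylor_leading_term[of "\<lambda>j. D w (Suc j)" p T "B (Suc (Suc p))" t] t' w B D Dzero
      by auto
    have "norm (D w 0 t) \<le> norm (D w 0 t - (t ^ Suc p / fact (Suc p)) *\<^sub>R a)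
        + norm ((t ^ Suc p / fact (Suc p)) *\<^sub>R a)"
      by (subst add.commute) (rule norm_triangle_sub)
    also have "\<dots> \<le> b * T * t ^ Suc p + B (Suc p) * t ^ Suc p"
    proof (rule add_mono)
      have "b * t ^ Suc (Suc p) = b * t * t ^ Suc p" by simp
      also have "\<dots> \<le> b * T * t ^ Suc p"
        using t' B0 by (intro mult_right_mono mult_left_mono) (auto simp: b_def)
      finally show "norm (D w 0 t - (t ^ Suc p / fact (Suc p)) *\<^sub>R a) \<le> b * T * t ^ Suc p"
        using e by linarith
      have "t ^ Suc p / fact (Suc p) \<le> t ^ Suc p"
        using t' fact_ge_1[of "Suc p", where 'a = real]
        by (simp add: divide_le_eq mult_le_cancel_left1 del: power_Suc fact_Suc)
      moreover have "norm a \<le> B (Suc p)"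
        unfolding a_def using w \<open>0 < T\<close> by (intro B) auto
      ultimately have "t ^ Suc p / fact (Suc p) * norm a \<le> t ^ Suc p * B (Suc p)"
        using t' by (intro mult_mono) auto
      then show "norm ((t ^ Suc p / fact (Suc p)) *\<^sub>R a) \<le> B (Suc p) * t ^ Suc p"
        using t' by (simp add: mult.commute del: power_Suc fact_Suc)
    qed
    finally have D_le: "norm (D w 0 t) \<le> M * t ^ Suc p"
      by (simp add: M_def algebra_simps)
    have nontriv: "at t within {0..} \<noteq> bot"
      using t' by (subst at_within_interior) auto
    have "((\<lambda>s. G 0 (s, u)) has_vector_derivative A (E t u)) (at t within {0..})"
      using \<open>is_exact_flow A E\<close> t' unfolding is_exact_flow_def by (simp add: G0)
    then have G1: "G 1 (t, u) = A (E t u)"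
      using vector_derivative_unique_within[OF nontriv Gderiv[of t u 0]] t' by simp
    have "((\<lambda>s. \<Phi> s u w) has_vector_derivative F 1 (t, u, w)) (at t within {0..})"
    proof (rule has_vector_derivative_transform)
      show "((\<lambda>s. F 0 (s, u, w)) has_vector_derivative F 1 (t, u, w)) (at t within {0..})"
        using Fderiv[of t "(u, w)" 0] t' w \<open>\<Omega> \<subseteq> U\<close> by auto
    qed (use t' w in \<open>auto simp: F0 \<Psi>\<close>)
    then have "vector_derivative (\<lambda>s. \<Phi> s u w) (at t within {0..}) = F 1 (t, u, w)"
      by (rule vector_derivative_within[OF nontriv])
    \<comment> \<open>The derivative of the exact flow is \<open>A (E t u)\<close>, so adding and
      subtracting it splits the defect into the derivative of the error and a Lipschitz
      term.\<close>
    then have defect: "defect A \<Phi> t u w = D w 1 t - (A (\<Phi> t u w) - A (E t u))"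
      by (simp add: defect_def D_def G1 del: One_nat_def)
    have "norm (A (\<Phi> t u w) - A (E t u)) \<le> L * norm (\<Phi> t u w - E t u)"
    proof (rule L(2))
      have "\<Phi> t u w = F 0 (t, u, w)" "E t u = G 0 (t, u)"
        using t' w by (auto simp: F0 G0 \<Psi>)
      then show "\<Phi> t u w \<in> F 0 ` ({0..T} \<times> {u} \<times> \<Omega>) \<union> G 0 ` ({0..T} \<times> {u})"
        "E t u \<in> F 0 ` ({0..T} \<times> {u} \<times> \<Omega>) \<union> G 0 ` ({0..T} \<times> {u})"
        using t' w by auto
    qed
    also have "\<dots> \<le> L * (M * t ^ Suc p)"
      using D_le L(1) t' w D0[of w t] by (intro mult_left_mono) (auto simp: local_error_def)
    finally have lip: "norm (A (\<Phi> t u w) - A (E t u)) \<le> L * (M * t ^ Suc p)" .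
    define r where "r = t / real (p + 1)"
    have r: "0 \<le> r" "r \<le> t"
      using t' by (auto simp: r_def divide_le_eq mult_le_cancel_left1)
    \<comment> \<open>The reason for the weight \<open>1 / (p + 1)\<close>: it makes
      \<open>r\<close> times the leading term of the derivative equal to the leading term of the
      error, so that both can be inserted below and cancel.\<close>
    have fact: "r * (t ^ p / fact p) = t ^ Suc p / fact (Suc p)"
      by (simp add: r_def field_simps)
    have "error_estimator p A \<Phi> t u w - local_error E \<Phi> t u w
        = r *\<^sub>R D w 1 t - r *\<^sub>R (A (\<Phi> t u w) - A (E t u)) - D w 0 t"
      using t' w by (simp add: error_estimator_def defect D0 r_def scaleR_diff_right)
    also have "\<dots> = r *\<^sub>R (D w 1 t - (t ^ p / fact p) *\<^sub>R a)
        - (D w 0 t - (t ^ Suc p / fact (Suc p)) *\<^sub>R a) - r *\<^sub>R (A (\<Phi> t u w) - A (E t u))"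
      unfolding fact[symmetric] by (simp add: scaleR_diff_right)
    also have "norm \<dots> \<le> r * (b * t ^ Suc p) + b * t ^ Suc (Suc p) + r * (L * (M * t ^ Suc p))"
    proof -
      have tri: "norm (x - y - z) \<le> X + Y + Z" if "norm x \<le> X" "norm y \<le> Y" "norm z \<le> Z"
        for x y z :: "real ^ 'm" and X Y Z :: real
        using that norm_triangle_ineq4[of "x - y" z] norm_triangle_ineq4[of x y] by linarith
      show ?thesis
        by (rule tri[OF _ e])
          (simp_all only: norm_scaleR abs_of_nonneg[OF r(1)] mult_left_mono[OF e' r(1)]
            mult_left_mono[OF lip r(1)])
    qed
    \<comment> \<open>Replacing \<open>r\<close> by \<open>t\<close> makes every summand a multiple
      of \<open>t^(p+2)\<close>: each expansion contributes \<open>b\<close>, the Lipschitz term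
      \<open>L * M\<close>.\<close>
    also have "\<dots> \<le> t * (b * t ^ Suc p) + b * t ^ Suc (Suc p) + t * (L * (M * t ^ Suc p))"
      using r t' L(1) B0 \<open>0 < T\<close> by (intro add_mono mult_right_mono) (auto simp: b_def M_def)
    also have "\<dots> = (2 * b + L * M) * t ^ (p + 2)"
      by (simp add: algebra_simps)
    finally have "c * norm (error_estimator p A \<Phi> t u w - local_error E \<Phi> t u w)
        \<le> c * ((2 * b + L * M) * t ^ (p + 2))"
      using c(1) by (intro mult_left_mono)
    with c(2) show ?thesis
      by (metis order_trans mult.assoc)
  qed
  then show "\<exists>C. \<forall>w\<in>\<Omega>. \<forall>dt\<in>{0<..T}.
      N (error_estimator p A \<Phi> dt u w - local_error E \<Phi> dt u w) \<le> C * dt ^ (p + 2)"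
    by blast
qed

end
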